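(* Let $\lambda_1,\lambda_2,\lambda_3\in\mathbb{R}$ and let $\mathrm{Im}(\mathbb{K})=T_{S_{\mathbb{K}}}(e)$ be the Lie algebra of the Lie group $S_{\mathbb{K}}$ of unit 3-parameter generalized quaternions. Let $X=x_1e_1+x_2e_2+x_3e_3\in\mathrm{Im}(\mathbb{K})$. Then the matrix, with respect to the basis $\{e_1,e_2,e_3\}$, of the linear map $Ad_X:\mathrm{Im}(\mathbb{K})\to\mathrm{Im}(\mathbb{K})$, $Ad_X(Y)=[X,Y]$, is $$Ad_X=\begin{bmatrix}0&-2\lambda_3x_3&2\lambda_3x_2\\2\lambda_2x_3&0&-2\lambda_2x_1\\-2\lambda_1x_2&2\lambda_1x_1&0\end{bmatrix}.$$
   Context: Given $\lambda_1,\lambda_2,\lambda_3\in\mathbb{R}$, $\mathbb{K}$ is the (associative, unital) real algebra with vector-space basis $1,e_1,e_2,e_3$, unit $1$, and bilinear multiplication determined by $e_1^2=-\lambda_1\lambda_2$, $e_2^2=-\lambda_1\lambda_3$, $e_3^2=-\lambda_2\lambda_3$, $e_1e_2=\lambda_1e_3=-e_2e_1$, $e_2e_3=\lambda_3e_1=-e_3e_2$, $e_3e_1=\lambda_2e_2=-e_1e_3$. $S_{\mathbb{K}}=\{a_0+a_1e_1+a_2e_2+a_3e_3:a_0^2+\lambda_1\lambda_2a_1^2+\lambda_1\lambda_3a_2^2+\lambda_2\lambda_3a_3^2=1\}$ is a Lie group under this multiplication with Lie algebra $T_{S_{\mathbb{K}}}(e)=\mathrm{Im}(\mathbb{K})=\mathrm{span}\{e_1,e_2,e_3\}$,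 whose Lie bracket is the bilinear antisymmetric map with $[e_1,e_2]=2\lambda_1e_3$, $[e_2,e_3]=2\lambda_3e_1$, $[e_3,e_1]=2\lambda_2e_2$. *)

theory Defs
  imports "HOL-Analysis.Analysis"
begin

section \<open>The algebra of 3-parameter generalized quaternions\<close>

text \<open>
  The element \<open>a\<^sub>0 + a\<^sub>1 e\<^sub>1 + a\<^sub>2 e\<^sub>2 + a\<^sub>3 e\<^sub>3\<close> is the vector with components
  \<open>a $ 0, a $ 1, a $ 2, a $ 3\<close>; the index type \<open>4\<close> is the ring of integers modulo 4, so its
  elements are \<open>0, 1, 2, 3\<close> (and \<open>4 = 0\<close>).  Only the multiplication depends on
  \<open>\<lambda>\<^sub>1, \<lambda>\<^sub>2, \<lambda>\<^sub>3\<close>, written \<open>l1, l2, l3\<close>.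
\<close>

type_synonym gquat = "real ^ 4"

definition gq_e :: "4 \<Rightarrow> gquat"
  where "gq_e i = axis i 1"

abbreviation gq_one :: gquat
  where "gq_one \<equiv> gq_e 0"

definition gq_table :: "real \<Rightarrow> real \<Rightarrow> real \<Rightarrow> 4 \<Rightarrow> 4 \<Rightarrow> gquat"
  where "gq_table l1 l2 l3 i j =
   (if i = 0 then gq_e j
    else if j = 0 then gq_e i
    else if i = 1 \<and> j = 1 then - (l1 * l2) *\<^sub>R gq_one
    else if i = 2 \<and> j = 2 then - (l1 * l3) *\<^sub>R gq_one
    else if i = 3 \<and> j = 3 then - (l2 * l3) *\<^sub>R gq_one
    else if i = 1 \<and> j = 2 then l1 *\<^sub>R gq_e 3
    else if i = 2 \<and> j = 1 then - l1 *\<^sub>R gq_e 3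
    else if i = 2 \<and> j = 3 then l3 *\<^sub>R gq_e 1
    else if i = 3 \<and> j = 2 then - l3 *\<^sub>R gq_e 1
    else if i = 3 \<and> j = 1 then l2 *\<^sub>R gq_e 2
    else - l2 *\<^sub>R gq_e 2)"

definition gq_mult :: "real \<Rightarrow> real \<Rightarrow> real \<Rightarrow> gquat \<Rightarrow> gquat \<Rightarrow> gquat"
  where "gq_mult l1 l2 l3 a b =
    (\<Sum>i\<in>UNIV. \<Sum>j\<in>UNIV. (a $ i * b $ j) *\<^sub>R gq_table l1 l2 l3 i j)"

definition gq_sphere :: "real \<Rightarrow> real \<Rightarrow> real \<Rightarrow> gquat set"
  where "gq_sphere l1 l2 l3 =
    {a. (a $ 0)\<^sup>2 + l1 * l2 * (a $ 1)\<^sup>2 + l1 * l3 * (a $ 2)\<^sup>2 + l2 * l3 * (a $ 3)\<^sup>2 = 1}"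

definition gq_Im_basis :: "gquat ^ 3"
  where "gq_Im_basis = vector [gq_e 1, gq_e 2, gq_e 3]"

definition gq_Im :: "gquat set"
  where "gq_Im = span (range (\<lambda>i. gq_Im_basis $ i))"


section \<open>The Lie algebra of the group of unit elements\<close>

text \<open>
  Tangent vectors are velocities of differentiable curves; for a submanifold \<open>S\<close> this is the
  tangent space at \<open>p\<close>.
\<close>

definition tangent_space :: "'a::real_normed_vector set \<Rightarrow> 'a \<Rightarrow> 'a set"
  where "tangent_space S p =
    {v. \<exists>c d. d > 0 \<and> c 0 = p \<and> c ` {-d<..<d} \<subseteq> S \<and>
          (\<forall>t\<in>{-d<..<d}. c differentiable (at (t::real))) \<and>
          (c has_vector_derivative v) (at 0)}"

text \<open>
  The left-invariant vector field generated by \<open>X\<close>: at \<open>g\<close> it is the image of \<open>X\<close> under the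
  differential at the unit of the left translation \<open>h \<mapsto> g h\<close>.  The formula makes sense at every
  \<open>g\<close> of the algebra, which extends the field from the submanifold of unit elements to the
  ambient vector space.
\<close>

definition gq_left_inv :: "real \<Rightarrow> real \<Rightarrow> real \<Rightarrow> gquat \<Rightarrow> gquat \<Rightarrow> gquat"
  where "gq_left_inv l1 l2 l3 X g = frechet_derivative (gq_mult l1 l2 l3 g) (at gq_one) X"

text \<open>
  The Lie bracket of vector fields on an open set of a normed space.  For fields
  tangent to a submanifold, its value at a point of the submanifold depends only on the
  restrictions of the fields to it and is their bracket there.
\<close>

definition vf_bracket ::
    "('a::real_normed_vector \<Rightarrow> 'a) \<Rightarrow> ('a \<Rightarrow> 'a) \<Rightarrow> 'a \<Rightarrow> 'a"
  where "vf_bracket V W p =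
    frechet_derivative W (at p) (V p) - frechet_derivative V (at p) (W p)"

definition gq_bracket :: "real \<Rightarrow> real \<Rightarrow> real \<Rightarrow> gquat \<Rightarrow> gquat \<Rightarrow> gquat"
  where "gq_bracket l1 l2 l3 X Y =
    vf_bracket (gq_left_inv l1 l2 l3 X) (gq_left_inv l1 l2 l3 Y) gq_one"

definition gq_Ad :: "real \<Rightarrow> real \<Rightarrow> real \<Rightarrow> gquat \<Rightarrow> gquat \<Rightarrow> gquat"
  where "gq_Ad l1 l2 l3 X Y = gq_bracket l1 l2 l3 X Y"


section \<open>The matrix of a linear map with respect to a basis\<close>

text \<open>
  Column \<open>j\<close> holds the coordinates of \<open>f (b $ j)\<close>.  Meaningful when the entries of \<open>b\<close> are
  distinct and linearly independent and \<open>f\<close> maps their span to itself.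
\<close>

definition matrix_wrt_basis :: "('a::real_vector) ^ 'n \<Rightarrow> ('a \<Rightarrow> 'a) \<Rightarrow> real ^ 'n ^ 'n"
  where "matrix_wrt_basis b f =
    (\<chi> i j. representation (range (\<lambda>k. b $ k)) (f (b $ j)) (b $ i))"


section \<open>Agreement with the standard facts\<close>

lemma four_eq_0: "(4::4) = 0"
  by simp

lemma UNIV_4_from_0: "(UNIV :: 4 set) = {0, 1, 2, 3}"
  using exhaust_4 unfolding four_eq_0 by blast

lemma sum_4_from_0: "sum f (UNIV :: 4 set) = f 0 + f 1 + f 2 + f 3"
  for f :: "4 \<Rightarrow> 'b::comm_monoid_add"
  using sum_4[of f] unfolding four_eq_0 by (simp only: ac_simps)

lemma gquat_eq_iff:
  "a = b \<longleftrightarrow> a $ 0 = b $ 0 \<and> a $ 1 = b $ 1 \<and> a $ 2 = b $ 2 \<and> a $ 3 = b $ 3"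
  for a b :: "'b ^ 4"
proof -
  have "(\<forall>i::4. P i) \<longleftrightarrow> P 0 \<and> P 1 \<and> P 2 \<and> P 3" for P
    using UNIV_4_from_0 by (metis UNIV_I empty_iff insert_iff)
  then show ?thesis by (simp add: vec_eq_iff)
qed

lemma gq_e_nth: "gq_e i $ j = (if j = i then 1 else 0)"
  by (simp add: gq_e_def axis_def)

lemma gq_mult_nth:
  "gq_mult l1 l2 l3 a b $ 0 =
     a$0 * b$0 - l1 * l2 * (a$1 * b$1) - l1 * l3 * (a$2 * b$2) - l2 * l3 * (a$3 * b$3)"
  "gq_mult l1 l2 l3 a b $ 1 = a$0 * b$1 + a$1 * b$0 + l3 * (a$2 * b$3 - a$3 * b$2)"
  "gq_mult l1 l2 l3 a b $ 2 = a$0 * b$2 + a$2 * b$0 + l2 * (a$3 * b$1 - a$1 * b$3)"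
  "gq_mult l1 l2 l3 a b $ 3 = a$0 * b$3 + a$3 * b$0 + l1 * (a$1 * b$2 - a$2 * b$1)"
  by (simp_all add: gq_mult_def sum_4_from_0 gq_table_def gq_e_nth algebra_simps)

lemma gq_mult_e:
  "gq_mult l1 l2 l3 (gq_e i) (gq_e j) = gq_table l1 l2 l3 i j"
proof -
  have "(\<Sum>j'\<in>UNIV. (gq_e i $ i' * gq_e j $ j') *\<^sub>R gq_table l1 l2 l3 i' j') =
      (if i' = i then gq_table l1 l2 l3 i j else 0)" for i'
  proof -
    have "(\<Sum>j'\<in>UNIV. (gq_e i $ i' * gq_e j $ j') *\<^sub>R gq_table l1 l2 l3 i' j') =
        (\<Sum>j'\<in>UNIV. if j' = j then (if i' = i then gq_table l1 l2 l3 i j else 0) else 0)"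
      by (rule sum.cong) (auto simp: gq_e_nth)
    then show ?thesis by simp
  qed
  then show ?thesis by (simp add: gq_mult_def)
qed

lemma gq_mult_assoc:
  "gq_mult l1 l2 l3 (gq_mult l1 l2 l3 a b) c = gq_mult l1 l2 l3 a (gq_mult l1 l2 l3 b c)"
  by (simp add: gquat_eq_iff gq_mult_nth algebra_simps)

lemma gq_mult_one:
  "gq_mult l1 l2 l3 gq_one a = a" "gq_mult l1 l2 l3 a gq_one = a"
  by (simp_all add: gquat_eq_iff gq_mult_nth gq_e_nth)

lemma bounded_bilinear_gq_mult: "bounded_bilinear (gq_mult l1 l2 l3)"
  by (intro bilinear_conv_bounded_bilinear[THEN iffD1])
    (auto simp: bilinear_def gquat_eq_iff gq_mult_nth algebra_simps intro!: linearI)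

lemma gq_sphere_one: "gq_one \<in> gq_sphere l1 l2 l3"
  by (simp add: gq_sphere_def gq_e_nth)

lemma gq_sphere_mult:
  assumes "a \<in> gq_sphere l1 l2 l3" "b \<in> gq_sphere l1 l2 l3"
  shows "gq_mult l1 l2 l3 a b \<in> gq_sphere l1 l2 l3"
proof -
  define N where
    "N a = (a $ 0)\<^sup>2 + l1 * l2 * (a $ 1)\<^sup>2 + l1 * l3 * (a $ 2)\<^sup>2 + l2 * l3 * (a $ 3)\<^sup>2" for a :: gquat
  have "N (gq_mult l1 l2 l3 a b) = N a * N b"
    unfolding N_def gq_mult_nth power2_eq_square by (simp add: algebra_simps)
  then show ?thesis
    using assms by (simp add: gq_sphere_def flip: N_def)
qed

lemma gq_sphere_inverse:
  assumes "a \<in> gq_sphere l1 l2 l3"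
  shows "\<exists>b \<in> gq_sphere l1 l2 l3. gq_mult l1 l2 l3 a b = gq_one \<and> gq_mult l1 l2 l3 b a = gq_one"
proof (rule bexI[of _ "\<chi> i. if i = 0 then a $ 0 else - a $ i"])
qed (use assms in \<open>auto simp: gq_sphere_def gquat_eq_iff gq_mult_nth gq_e_nth
       power2_eq_square algebra_simps\<close>)

lemma gq_Im_basis_range: "range (\<lambda>i. gq_Im_basis $ i) = {gq_e 1, gq_e 2, gq_e 3}"
  unfolding UNIV_3 gq_Im_basis_def by simp

lemma gq_Im_basis_inj: "inj (\<lambda>i. gq_Im_basis $ i)"
proof (rule injI)
  fix i j :: 3
  assume "gq_Im_basis $ i = gq_Im_basis $ j"
  then show "i = j"
    using exhaust_3[of i] exhaust_3[of j]
    by (auto simp: gq_Im_basis_def gquat_eq_iff gq_e_nth)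
qed

lemma gq_Im_basis_independent: "independent (range (\<lambda>i. gq_Im_basis $ i))"
proof (rule independent_mono[OF independent_Basis])
  show "range (\<lambda>i. gq_Im_basis $ i) \<subseteq> Basis"
    unfolding gq_Im_basis_range by (auto simp: gq_e_def Basis_vec_def)
qed

lemma gq_Im_iff: "a \<in> gq_Im \<longleftrightarrow> a $ 0 = 0"
proof
  assume "a \<in> gq_Im"
  moreover have "gq_Im \<subseteq> {a. a $ 0 = 0}"
    unfolding gq_Im_def gq_Im_basis_range
    by (rule span_minimal) (auto simp: gq_e_nth subspace_def)
  ultimately show "a $ 0 = 0" by blast
next
  assume "a $ 0 = 0"
  then have "a = a $ 1 *\<^sub>R gq_e 1 + a $ 2 *\<^sub>R gq_e 2 + a $ 3 *\<^sub>R gq_e 3"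
    by (simp add: gquat_eq_iff gq_e_nth)
  moreover have "\<dots> \<in> gq_Im"
    unfolding gq_Im_def gq_Im_basis_range
    by (intro span_add span_scale span_base) auto
  ultimately show "a \<in> gq_Im" by simp
qed

lemma gq_tangent_space: "tangent_space (gq_sphere l1 l2 l3) gq_one = gq_Im"
proof (intro subset_antisym subsetI)
  fix v assume "v \<in> tangent_space (gq_sphere l1 l2 l3) gq_one"
  then obtain c d where d: "d > 0" and c0: "c 0 = gq_one"
    and cS: "c ` {-d<..<d} \<subseteq> gq_sphere l1 l2 l3"
    and cv: "(c has_vector_derivative v) (at 0)"
    unfolding tangent_space_def by blast
  let ?F = "\<lambda>t. (c t $ 0)\<^sup>2 + l1 * l2 * (c t $ 1)\<^sup>2 + l1 * l3 * (c t $ 2)\<^sup>2 + l2 * l3 * (c t $ 3)\<^sup>2"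
  have ci: "((\<lambda>t. c t $ i) has_real_derivative v $ i) (at 0)" for i
    using bounded_linear.has_vector_derivative[OF bounded_linear_vec_nth cv]
    by (simp add: has_real_derivative_iff_has_vector_derivative)
  have "(?F has_real_derivative 2 * v $ 0) (at 0)"
    by (rule derivative_eq_intros ci refl)+ (simp add: c0 gq_e_nth)
  moreover have "((\<lambda>_. 1) has_real_derivative 2 * v $ 0) (at 0)"
  proof (rule has_field_derivative_transform_within_open[OF calculation])
    show "open {-d<..<d}" "0 \<in> {-d<..<d}" using d by auto
    show "?F t = 1" if "t \<in> {-d<..<d}" for t
      using cS that unfolding gq_sphere_def by blast
  qed
  ultimately have "2 * v $ 0 = 0"
    by (metis DERIV_const DERIV_unique)
  then show "v \<in> gq_Im" by (simp add: gq_Im_iff)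
next
  fix v assume "v \<in> gq_Im"
  then have v0: "v $ 0 = 0" by (simp add: gq_Im_iff)
  define q where "q = l1 * l2 * (v$1)\<^sup>2 + l1 * l3 * (v$2)\<^sup>2 + l2 * l3 * (v$3)\<^sup>2"
  define c where "c t = sqrt (1 - t\<^sup>2 * q) *\<^sub>R gq_one + t *\<^sub>R v" for t
  define d where "d = 1 / (1 + \<bar>q\<bar>)"
  have d: "0 < d" "d \<le> 1" by (auto simp: d_def)
  have pos: "1 - t\<^sup>2 * q > 0" if "t \<in> {-d<..<d}" for t
  proof -
    have "\<bar>t\<bar> < d" using that by auto
    then have "\<bar>t\<bar> * \<bar>t\<bar> \<le> 1 * \<bar>t\<bar>"
      using d by (intro mult_right_mono) auto
    then have t2: "t\<^sup>2 \<le> \<bar>t\<bar>"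
      by (simp add: power2_eq_square)
    have "t\<^sup>2 * q \<le> t\<^sup>2 * \<bar>q\<bar>"
      by (intro mult_left_mono) auto
    also have "\<dots> \<le> \<bar>t\<bar> * \<bar>q\<bar>"
      using t2 by (intro mult_right_mono) auto
    also have "\<dots> \<le> d * \<bar>q\<bar>" using \<open>\<bar>t\<bar> < d\<close> by (simp add: mult_right_mono)
    also have "\<dots> < 1" by (simp add: d_def)
    finally show ?thesis by simp
  qed
  have deriv: "(c has_vector_derivative
      (inverse (sqrt (1 - t\<^sup>2 * q)) / 2 * (- (2 * t * q))) *\<^sub>R gq_one + v) (at t)"
    if "t \<in> {-d<..<d}" for t
  proof -
    have "((\<lambda>t. 1 - t\<^sup>2 * q) has_real_derivative - (2 * t * q)) (at t)"
      by (auto intro!: derivative_eq_intros)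
    from DERIV_chain2[OF DERIV_real_sqrt[OF pos[OF that]] this]
    have "((\<lambda>t. sqrt (1 - t\<^sup>2 * q)) has_vector_derivative
        inverse (sqrt (1 - t\<^sup>2 * q)) / 2 * (- (2 * t * q))) (at t)"
      by (simp only: has_real_derivative_iff_has_vector_derivative)
    from has_vector_derivative_add[OF
        bounded_linear.has_vector_derivative[OF bounded_linear_scaleR_left this, of gq_one]
        bounded_linear.has_vector_derivative[OF bounded_linear_scaleR_left
          has_vector_derivative_id, of v]]
    show ?thesis
      unfolding c_def by (simp only: scaleR_one id_apply)
  qed
  have "c 0 = gq_one" by (simp add: c_def)
  moreover have "c ` {-d<..<d} \<subseteq> gq_sphere l1 l2 l3"
  proof
    fix a assume "a \<in> c ` {-d<..<d}"
    then obtain t where t: "t \<in> {-d<..<d}" and a: "a = c t" by blast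
    have "a $ 0 = sqrt (1 - t\<^sup>2 * q)" "a $ 1 = t * v $ 1" "a $ 2 = t * v $ 2" "a $ 3 = t * v $ 3"
      by (simp_all add: a c_def gq_e_nth v0)
    then show "a \<in> gq_sphere l1 l2 l3"
      using pos[OF t] by (simp add: gq_sphere_def q_def power_mult_distrib algebra_simps)
  qed
  moreover have "\<forall>t\<in>{-d<..<d}. c differentiable (at t)"
    using deriv differentiableI_vector by blast
  moreover have "(c has_vector_derivative v) (at 0)"
    using deriv[of 0] d by simp
  ultimately show "v \<in> tangent_space (gq_sphere l1 l2 l3) gq_one"
    unfolding tangent_space_def using d by blast
qed

lemma frechet_derivative_bounded_linear:
  "frechet_derivative f (at p) = f" if "bounded_linear f"
  using frechet_derivative_at[OF bounded_linear_imp_has_derivative[OF that]] by (rule sym)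

lemma gq_left_inv_eq: "gq_left_inv l1 l2 l3 X g = gq_mult l1 l2 l3 g X"
  unfolding gq_left_inv_def
  by (subst frechet_derivative_bounded_linear)
    (rule bounded_bilinear.bounded_linear_right[OF bounded_bilinear_gq_mult], rule refl)

lemma gq_bracket_commutator:
  "gq_bracket l1 l2 l3 X Y = gq_mult l1 l2 l3 X Y - gq_mult l1 l2 l3 Y X"
proof -
  have "frechet_derivative (\<lambda>g. gq_mult l1 l2 l3 g Z) (at p) = (\<lambda>g. gq_mult l1 l2 l3 g Z)" for Z p
    by (intro frechet_derivative_bounded_linear
        bounded_bilinear.bounded_linear_left[OF bounded_bilinear_gq_mult])
  moreover have "gq_left_inv l1 l2 l3 Z = (\<lambda>g. gq_mult l1 l2 l3 g Z)" for Z
    by (simp add: fun_eq_iff gq_left_inv_eq)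
  ultimately show ?thesis
    by (simp add: gq_bracket_def vf_bracket_def gq_mult_one)
qed

lemma gq_bracket_basis:
  "gq_bracket l1 l2 l3 (gq_e 1) (gq_e 2) = (2 * l1) *\<^sub>R gq_e 3"
  "gq_bracket l1 l2 l3 (gq_e 2) (gq_e 3) = (2 * l3) *\<^sub>R gq_e 1"
  "gq_bracket l1 l2 l3 (gq_e 3) (gq_e 1) = (2 * l2) *\<^sub>R gq_e 2"
  by (simp_all add: gq_bracket_commutator gq_mult_e gq_table_def gquat_eq_iff gq_e_nth)

lemma gq_bracket_antisym: "gq_bracket l1 l2 l3 X Y = - gq_bracket l1 l2 l3 Y X"
  by (simp add: gq_bracket_commutator)

lemma gq_bracket_bilinear: "bilinear (gq_bracket l1 l2 l3)"
  by (auto simp: bilinear_def gq_bracket_commutator gquat_eq_iff gq_mult_nth algebra_simps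
      intro!: linearI)

end

theory Submission
  imports Defs
begin

text \<open>
  The bracket of left-invariant fields is the commutator of the algebra.  The commutator kills the
  symmetric part of the multiplication table: the products with the unit and the squares of
  \<open>e\<^sub>1, e\<^sub>2, e\<^sub>3\<close>.  What remains is the cross product of the imaginary parts, with its three
  components weighted by \<open>2 \<lambda>\<^sub>3, 2 \<lambda>\<^sub>2, 2 \<lambda>\<^sub>1\<close> (lemma \<open>gq_bracket_nth\<close>).  It has no unit component,
  so \<open>Ad\<^sub>X\<close> maps into the imaginary part, which is the tangent space at the unit.  There,
  coordinates with respect to \<open>e\<^sub>1, e\<^sub>2, e\<^sub>3\<close> are just vector components
  (lemma \<open>gq_Im_representation\<close>), so the columns of the matrix are the weighted cross products of
  \<open>X\<close> with the basis vectors.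
\<close>

lemma gq_bracket_nth:
  "gq_bracket l1 l2 l3 X Y $ 0 = 0"
  "gq_bracket l1 l2 l3 X Y $ 1 = 2 * l3 * (X $ 2 * Y $ 3 - X $ 3 * Y $ 2)"
  "gq_bracket l1 l2 l3 X Y $ 2 = 2 * l2 * (X $ 3 * Y $ 1 - X $ 1 * Y $ 3)"
  "gq_bracket l1 l2 l3 X Y $ 3 = 2 * l1 * (X $ 1 * Y $ 2 - X $ 2 * Y $ 1)"
  by (simp_all add: gq_bracket_commutator gq_mult_nth algebra_simps)

text \<open>
  Coordinates in \<^const>\<open>representation\<close> are indexed by the basis vectors themselves;
  injectivity of the family allows an index to stand for its vector.
\<close>

lemma representation_indexed_family:
  fixes b :: "'a::real_vector ^ 'n"
  assumes indep: "independent (range (\<lambda>k. b $ k))" and inj: "inj (\<lambda>k. b $ k)"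
  shows "representation (range (\<lambda>k. b $ k)) (\<Sum>k\<in>UNIV. c k *\<^sub>R b $ k) (b $ i) = c i"
proof -
  let ?B = "range (\<lambda>k. b $ k)"
  have "representation ?B (\<Sum>k\<in>UNIV. c k *\<^sub>R b $ k) (b $ i)
      = (\<Sum>k\<in>UNIV. representation ?B (c k *\<^sub>R b $ k) (b $ i))"
    by (subst representation_sum[OF indep]) (auto intro: span_scale span_base)
  also have "\<dots> = (\<Sum>k\<in>UNIV. c k * (if b $ k = b $ i then 1 else 0))"
    by (rule sum.cong)
      (simp_all add: representation_scale[OF indep] span_base representation_basis[OF indep])
  also have "\<dots> = (\<Sum>k\<in>UNIV. if k = i then c k else 0)"
    using inj by (intro sum.cong) (auto dest: injD)
  finally show ?thesis by simp
qed

lemma gq_Im_representation: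
  fixes Z :: gquat
  assumes "Z $ 0 = 0"
  shows "representation (range (\<lambda>k. gq_Im_basis $ k)) Z (gq_Im_basis $ i)
    = (vector [Z $ 1, Z $ 2, Z $ 3] :: real ^ 3) $ i"
proof -
  have "Z = (\<Sum>k\<in>UNIV. (vector [Z $ 1, Z $ 2, Z $ 3] :: real ^ 3) $ k *\<^sub>R gq_Im_basis $ k)"
    using assms by (simp add: sum_3 gq_Im_basis_def gquat_eq_iff gq_e_nth)
  then show ?thesis
    using representation_indexed_family[OF gq_Im_basis_independent gq_Im_basis_inj]
    by metis
qed

theorem theorem5p6:
  fixes l1 l2 l3 x1 x2 x3 :: real and X :: gquat
  assumes "X = x1 *\<^sub>R gq_e 1 + x2 *\<^sub>R gq_e 2 + x3 *\<^sub>R gq_e 3"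
  shows "linear (gq_Ad l1 l2 l3 X) \<and>
    gq_Ad l1 l2 l3 X ` tangent_space (gq_sphere l1 l2 l3) gq_one
      \<subseteq> tangent_space (gq_sphere l1 l2 l3) gq_one \<and>
    matrix_wrt_basis gq_Im_basis (gq_Ad l1 l2 l3 X) =
      vector [vector [0, - 2 * l3 * x3, 2 * l3 * x2],
              vector [2 * l2 * x3, 0, - 2 * l2 * x1],
              vector [- 2 * l1 * x2, 2 * l1 * x1, 0]]"
proof (intro conjI)
  show "linear (gq_Ad l1 l2 l3 X)"
    using gq_bracket_bilinear by (simp add: bilinear_def gq_Ad_def[abs_def])
  show "gq_Ad l1 l2 l3 X ` tangent_space (gq_sphere l1 l2 l3) gq_one
      \<subseteq> tangent_space (gq_sphere l1 l2 l3) gq_one"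
    by (auto simp: gq_tangent_space gq_Im_iff gq_Ad_def gq_bracket_nth)
  have X: "X $ 1 = x1" "X $ 2 = x2" "X $ 3 = x3"
    by (simp_all add: assms gq_e_nth)
  show "matrix_wrt_basis gq_Im_basis (gq_Ad l1 l2 l3 X) =
      vector [vector [0, - 2 * l3 * x3, 2 * l3 * x2],
              vector [2 * l2 * x3, 0, - 2 * l2 * x1],
              vector [- 2 * l1 * x2, 2 * l1 * x1, 0]]"
    by (simp add: vec_eq_iff forall_3 matrix_wrt_basis_def gq_Ad_def gq_Im_representation
        gq_bracket_nth X)
      (simp add: gq_Im_basis_def gq_e_nth)
qed

end
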